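(* Let $C>0$ and let $P:[0,\infty)\to\mathbb{R}$ be twice differentiable with $P(0)>0$ and $P''(s)>0$ for all $s\ge0$, such that for some $s^*>0$ the function $P(s)/s$ is decreasing for $0<s<s^*$ and attains its minimum over $(0,\infty)$ at $s^*$. Let $a_1,\dots,a_n$ be positive integers with $a_{max}=\max_i a_i\ge2$, let $0<\epsilon<1/2$ and $\delta>0$. Define $R(s)=P(s)-\frac{P(s^* )}{s^*}s$, $d=(1-\epsilon)s^*$, $e=C/R(d)$, $f=\frac{C}{P(0)a_{max}}$, $k=\frac{-R'(d)}{fR(d)}$, $L_i=e-fa_i$, $l_i=dL_i-\frac{a_i}{k}$, $B=\frac{\sum_{i=1}^n a_i}{2k}$ and $F(x)=\frac{P(s^* )}{s^*}x+C$. Then there is a subset $A'\subset\{a_1,\dots,a_n\}$ (as a sub-multiset) with $\sum_{a_i\in A'}a_i=\sum_{a_i\notin A'}a_i$ if and only if there exists a feasible schedule for the instance $I_S$ described below with total energy consumption at most $$(n+1)\delta P(s^* )+\sum_{i=1}^n F(l_i)+B\,P'(d).$$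
   Context: Scheduling model: a single processor, preemption allowed. At each moment the processor is either asleep (processes nothing, consumes no energy) or active at some speed $s\ge0$, consuming energy at rate $P(s)$ and processing work at rate $s$. Each transition from sleep to active costs $C$ energy; transitions from active to sleep are free. The processor is active at time $0$ (the earliest release time), and energy is counted over the time span of the instance; total energy is the integral of $P(s(t))$ over active times plus $C$ times the number of sleep-to-active transitions. A schedule is feasible if each job receives its full volume of processing between its release time and deadline. The instance $I_S$: set $t_0=0$ and $t_i=t_{i-1}+\delta+L_i$ for $i=1,\dots,n$. Level-2 jobs: for $j=0,\dots,n$, a job with release time $t_j$, deadline $t_j+\delta$ and volume $\delta s^*$. Level-1 jobs: for $i=1,\dots,n$, a job with release time $t_{i-1}+\delta$, deadline $t_i$ and volume $l_i$. Level-0 job: a single job with release time $0$, deadline $t_n+\delta$ and volume $B$. *)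

theory Defs
  imports "HOL-Analysis.Analysis" "HOL-Library.Multiset"
begin

record 'j sched_instance =
  jobs :: "'j set"
  release :: "'j \<Rightarrow> real"
  deadline :: "'j \<Rightarrow> real"
  volume :: "'j \<Rightarrow> real"

definition start_time :: "'j sched_instance \<Rightarrow> real" where
  "start_time I = Min (release I ` jobs I)"

definition time_span :: "'j sched_instance \<Rightarrow> real set" where
  "time_span I = {start_time I .. Max (deadline I ` jobs I)}"

text \<open>At most one job is processed at a time; preemption is possible because
  \<open>current\<close> is an arbitrary function of time. The processor is asleep exactly at the times
  in \<open>asleep\<close>; being active at speed 0 is different from being asleep.\<close>

record 'j schedule =
  asleep :: "real set"
  speed :: "real \<Rightarrow> real"
  current :: "real \<Rightarrow> 'j option"

text \<open>An active processor at speed \<open>s\<close> processes work at rate \<open>s\<close>: a positive speed is only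
  possible while some job is processed, so every job receives exactly its volume. (The power
  function need not be monotone, so running faster without processing work could otherwise
  save energy.) The last condition also makes the speed measurable on the time span.\<close>

definition feasible :: "'j sched_instance \<Rightarrow> 'j schedule \<Rightarrow> bool" where
  "feasible I S \<longleftrightarrow>
     asleep S \<subseteq> time_span I \<and>
     start_time I \<notin> asleep S \<and>
     (\<forall>t \<in> time_span I. 0 \<le> speed S t) \<and>
     (\<forall>t \<in> asleep S. current S t = None) \<and>
     (\<forall>t \<in> time_span I. current S t = None \<longrightarrow> speed S t = 0) \<and>
     (\<forall>t \<in> time_span I. \<forall>j. current S t = Some j \<longrightarrow>
        j \<in> jobs I \<and> release I j \<le> t \<and> t \<le> deadline I j) \<and>
     (\<forall>j \<in> jobs I. has_bochner_integral lborel
        (\<lambda>t. indicator {t \<in> time_span I. current S t = Some j} t * speed S t) (volume I j))"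

text \<open>The connected components of the set of sleeping times are the maximal sleep periods.
  Each of them that is followed by an active time within the time span ends with one
  transition from sleep to active.\<close>

definition wakeups :: "'j sched_instance \<Rightarrow> 'j schedule \<Rightarrow> real set set" where
  "wakeups I S =
     {K \<in> components (asleep S). \<exists>u \<in> time_span I - asleep S. \<forall>t \<in> K. t < u}"

text \<open>The total functions \<open>card\<close> and \<open>LINT\<close> return 0 on infinite sets and on non-integrable
  functions; \<open>finite_energy\<close> excludes both cases.\<close>

definition finite_energy :: "(real \<Rightarrow> real) \<Rightarrow> 'j sched_instance \<Rightarrow> 'j schedule \<Rightarrow> bool" where
  "finite_energy P I S \<longleftrightarrow>
     finite (components (asleep S)) \<and>
     set_integrable lborel (time_span I - asleep S) (\<lambda>t. P (speed S t))"

definition energy :: "(real \<Rightarrow> real) \<Rightarrow> real \<Rightarrow> 'j sched_instance \<Rightarrow> 'j schedule \<Rightarrow> real" where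
  "energy P C I S =
     (LINT t:(time_span I - asleep S)|lborel. P (speed S t)) + C * real (card (wakeups I S))"

datatype job = Level0 | Level1 nat | Level2 nat

primrec tpoint :: "real \<Rightarrow> (nat \<Rightarrow> real) \<Rightarrow> nat \<Rightarrow> real" where
  "tpoint \<delta> L 0 = 0"
| "tpoint \<delta> L (Suc i) = tpoint \<delta> L i + \<delta> + L (Suc i)"

definition instance_IS ::
    "nat \<Rightarrow> real \<Rightarrow> real \<Rightarrow> (nat \<Rightarrow> real) \<Rightarrow> (nat \<Rightarrow> real) \<Rightarrow> real \<Rightarrow> job sched_instance" where
  "instance_IS n \<delta> sstar L l B =
     \<lparr> jobs = {Level0} \<union> Level1 ` {1..n} \<union> Level2 ` {0..n},
       release = (\<lambda>x. case x of
           Level0 \<Rightarrow> 0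
         | Level1 i \<Rightarrow> tpoint \<delta> L (i - 1) + \<delta>
         | Level2 j \<Rightarrow> tpoint \<delta> L j),
       deadline = (\<lambda>x. case x of
           Level0 \<Rightarrow> tpoint \<delta> L n + \<delta>
         | Level1 i \<Rightarrow> tpoint \<delta> L i
         | Level2 j \<Rightarrow> tpoint \<delta> L j + \<delta>),
       volume = (\<lambda>x. case x of
           Level0 \<Rightarrow> B
         | Level1 i \<Rightarrow> l i
         | Level2 j \<Rightarrow> \<delta> * sstar) \<rparr>"

end

theory Submission imports Defs begin

text \<open>
  Write \<open>\<kappa> = P sstar / sstar\<close>, \<open>R s = P s - \<kappa> s\<close> and \<open>m = R' d < 0\<close>. Since every schedule processes the
  same total volume, the energy bound says that the integral of \<open>R\<close> over the active times plus
  \<open>C\<close> per wake-up is at most \<open>n C + m B\<close>. Let \<open>x\<^sub>i\<close> be the level-0 work done in the gap of length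
  \<open>L i\<close>. A gap that contains sleep costs at least \<open>C \<ge> C + m x\<^sub>i\<close>, with equality only for
  \<open>x\<^sub>i = 0\<close>. In a gap without sleep the tangent of \<open>R\<close> at \<open>d\<close> gives a cost of at least
  \<open>L i R d + m (l i + x\<^sub>i - d L i) = C + m x\<^sub>i\<close>, with equality only if the speed is \<open>d\<close> almost
  everywhere, i.e. \<open>x\<^sub>i = a i / k\<close>. Level-2 blocks cost at least \<open>0\<close>. So the bound is always
  attained or exceeded, and it is attained only if \<open>B = (\<Sum>i\<in>N. a i / k)\<close>, where \<open>N\<close> is the set
  of gaps without sleep; so the numbers indexed by \<open>N\<close> have half of the total sum. Conversely, given
  such an \<open>N\<close>, run at speed \<open>d\<close> throughout the gaps in \<open>N\<close>; in the other gaps run at \<open>sstar\<close> until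
  the level-1 job is done and then sleep.
\<close>

section \<open>Components of unions, strict convexity, submultisets, schedules made of
  constant-speed slots\<close>

text \<open>Every component meets some \<open>X i\<close> and, as \<open>X i\<close> is connected,
  contains it. So it is the component of whichever point was chosen from \<open>X i\<close>, and the
  indices in \<open>Z\<close> account for all components.\<close>

lemma card_components_UN_le:
  assumes "finite Z" and con: "\<And>i. i \<in> Z \<Longrightarrow> connected (X i)"
  shows "finite (components (\<Union>i\<in>Z. X i))" and "card (components (\<Union>i\<in>Z. X i)) \<le> card Z"
proof -
  let ?U = "\<Union>i\<in>Z. X i"
  have sub: "components ?U \<subseteq> (\<lambda>i. connected_component_set ?U (SOME x. x \<in> X i)) ` Z"
  proof
    fix K assume "K \<in> components ?U"
    then obtain i x where i: "i \<in> Z" "x \<in> X i" and K: "K = connected_component_set ?U x"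
      by (auto simp: components_iff)
    have "(SOME x. x \<in> X i) \<in> X i" using i by (metis someI)
    moreover have "X i \<subseteq> connected_component_set ?U x"
      using i con by (intro connected_component_maximal) auto
    ultimately have "connected_component_set ?U (SOME x. x \<in> X i) = K"
      unfolding K by (metis connected_component_eq subsetD)
    then show "K \<in> (\<lambda>i. connected_component_set ?U (SOME x. x \<in> X i)) ` Z"
      using i by blast
  qed
  show "finite (components ?U)" using sub \<open>finite Z\<close> finite_surj by blast
  show "card (components ?U) \<le> card Z" using sub \<open>finite Z\<close> surj_card_le by blast
qed

text \<open>The mean value theorem for \<open>f'\<close> makes \<open>f'\<close> strictly
  increasing; applied to \<open>f\<close>, it then compares the chord with the tangent. Derivatives
  within \<open>{0..}\<close> suffice for this, so \<open>x\<close> or \<open>y\<close> may be the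
  endpoint 0.\<close>

lemma above_tangent_if_second_derivative_pos:
  fixes f f' f'' :: "real \<Rightarrow> real"
  assumes f: "\<And>s. s \<ge> 0 \<Longrightarrow> (f has_real_derivative f' s) (at s within {0..})"
    and f': "\<And>s. s \<ge> 0 \<Longrightarrow> (f' has_real_derivative f'' s) (at s within {0..})"
    and f'': "\<And>s. s \<ge> 0 \<Longrightarrow> f'' s > 0"
    and xy: "0 \<le> x" "0 \<le> y" "x \<noteq> y"
  shows "f x + f' x * (y - x) < f y"
proof -
  have mvt: "\<exists>z\<in>{u<..<v}. g v - g u = g' z * (v - u)"
    if "\<And>s. s \<ge> 0 \<Longrightarrow> (g has_real_derivative g' s) (at s within {0..})" "0 \<le> u" "u < v"
    for g g' :: "real \<Rightarrow> real" and u v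
  proof (rule mvt_simple[OF that(3)])
    fix z assume "u \<le> z" "z \<le> v"
    then have "(g has_real_derivative g' z) (at z within {u..v})"
      using that(2) by (intro has_field_derivative_subset[OF that(1)]) auto
    then show "(g has_derivative (*) (g' z)) (at z within {u..v})"
      by (simp add: has_field_derivative_def)
  qed
  have incr: "f' u < f' v" if uv: "0 \<le> u" "u < v" for u v
  proof -
    obtain z where "z \<in> {u<..<v}" "f' v - f' u = f'' z * (v - u)"
      using mvt[OF f' uv] by blast
    then show ?thesis using f''[of z] uv by (smt (verit) greaterThanLessThan_iff mult_pos_pos)
  qed
  show ?thesis
  proof (cases "x < y")
    case True
    then obtain z where z: "z \<in> {x<..<y}" "f y - f x = f' z * (y - x)"
      using mvt[OF f xy(1)] by blast
    then have "f' x * (y - x) < f' z * (y - x)"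
      using incr[of x z] xy True by (intro mult_strict_right_mono) auto
    then show ?thesis using z(2) by linarith
  next
    case False
    then have "y < x" using xy by simp
    then obtain z where z: "z \<in> {y<..<x}" "f x - f y = f' z * (x - y)"
      using mvt[OF f xy(2)] by blast
    then have "f' z * (x - y) < f' x * (x - y)"
      using incr[of z x] xy \<open>y < x\<close> by (intro mult_strict_right_mono) auto
    then show ?thesis using z by (simp add: algebra_simps)
  qed
qed

text \<open>Passing from numbers to indices: equal numbers at different indices stay
  distinguishable, so gaps can be selected by index.\<close>

lemma halving_submultiset_iff:
  fixes a :: "'i \<Rightarrow> nat"
  assumes I: "finite I"
  defines "A \<equiv> image_mset a (mset_set I)"
  shows "(\<exists>A'. A' \<subseteq># A \<and> \<Sum>\<^sub># A' = \<Sum>\<^sub># (A - A')) \<longleftrightarrow> (\<exists>N \<subseteq> I. 2 * (\<Sum>i\<in>N. a i) = (\<Sum>i\<in>I. a i))"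
proof
  have total: "\<Sum>\<^sub># A = (\<Sum>i\<in>I. a i)" by (simp add: A_def sum_unfold_sum_mset)
  {
    assume "\<exists>A'. A' \<subseteq># A \<and> \<Sum>\<^sub># A' = \<Sum>\<^sub># (A - A')"
    then obtain A' where A': "A' \<subseteq># A" "\<Sum>\<^sub># A' = \<Sum>\<^sub># (A - A')" by blast
    have "image_mset a (mset_set I) = A' + (A - A')" using A' by (simp add: A_def)
    then obtain M M' where M: "mset_set I = M + M'" "A' = image_mset a M"
      by (auto dest: image_mset_eq_plusD)
    \<comment> \<open>No multiplicity in \<open>mset_set I\<close> exceeds 1, so its part
      \<open>M\<close> is the multiset of a set of indices.\<close>
    have "M = mset_set (set_mset M)"
    proof (rule multiset_eqI)
      fix x
      have "count M x \<le> count (mset_set I) x" by (simp add: M)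
      also have "\<dots> \<le> 1" using I by (cases "x \<in> I") auto
      finally have "count M x \<le> 1" .
      then show "count M x = count (mset_set (set_mset M)) x"
        by (cases "x \<in># M") (auto simp: not_in_iff le_Suc_eq simp flip: count_greater_zero_iff)
    qed
    then have "\<Sum>\<^sub># A' = (\<Sum>i\<in>set_mset M. a i)" by (metis M(2) sum_unfold_sum_mset)
    moreover have "\<Sum>\<^sub># A = \<Sum>\<^sub># A' + \<Sum>\<^sub># (A - A')"
      using A' by (metis subset_mset.add_diff_inverse sum_mset.union)
    moreover have "set_mset M \<subseteq> I"
      using I M by (metis finite_set_mset_mset_set mset_subset_eq_add_left set_mset_mono)
    ultimately show "\<exists>N \<subseteq> I. 2 * (\<Sum>i\<in>N. a i) = (\<Sum>i\<in>I. a i)"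
      using A' total by (intro exI[of _ "set_mset M"]) auto
  }
  assume "\<exists>N \<subseteq> I. 2 * (\<Sum>i\<in>N. a i) = (\<Sum>i\<in>I. a i)"
  then obtain N where N: "N \<subseteq> I" "2 * (\<Sum>i\<in>N. a i) = (\<Sum>i\<in>I. a i)" by blast
  let ?A' = "image_mset a (mset_set N)"
  have sub: "?A' \<subseteq># A" unfolding A_def
    using N I by (intro image_mset_subseteq_mono) (simp add: subset_imp_msubset_mset_set)
  then have "\<Sum>\<^sub># A = \<Sum>\<^sub># ?A' + \<Sum>\<^sub># (A - ?A')"
    by (metis subset_mset.add_diff_inverse sum_mset.union)
  then have "\<Sum>\<^sub># ?A' = \<Sum>\<^sub># (A - ?A')"
    using N total by (simp add: sum_unfold_sum_mset)
  then show "\<exists>A'. A' \<subseteq># A \<and> \<Sum>\<^sub># A' = \<Sum>\<^sub># (A - A')" using sub by blast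
qed

text \<open>Job \<open>j\<close> runs at the constant speed \<open>sp j\<close> on its slot
  \<open>J j\<close>, and the processor sleeps on \<open>Z\<close>; by \<open>cover\<close> it is
  always doing one or the other. The energy is only bounded from above because a sleep period
  reaching the end of the time span causes no wake-up.\<close>

lemma schedule_of_disjoint_slots:
  fixes I :: "'j sched_instance" and J :: "'j \<Rightarrow> real set" and sp :: "'j \<Rightarrow> real"
  assumes fin: "finite (jobs I)"
    and disj: "\<And>i j x. i \<in> jobs I \<Longrightarrow> j \<in> jobs I \<Longrightarrow> x \<in> J i \<Longrightarrow> x \<in> J j \<Longrightarrow> i = j"
    and win: "\<And>j. j \<in> jobs I \<Longrightarrow> J j \<subseteq> {release I j .. deadline I j}"
    and meas: "\<And>j. j \<in> jobs I \<Longrightarrow> J j \<in> sets borel"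
    and sp: "\<And>j. j \<in> jobs I \<Longrightarrow> 0 \<le> sp j"
    and vol: "\<And>j. j \<in> jobs I \<Longrightarrow> volume I j = sp j * measure lborel (J j)"
    and Z: "Z \<subseteq> time_span I" "start_time I \<notin> Z" "finite (components Z)"
    and cover: "time_span I - Z = (\<Union>j\<in>jobs I. J j)"
    and C: "0 \<le> C"
  shows "\<exists>S. feasible I S \<and> finite_energy P I S \<and>
    energy P C I S \<le> (\<Sum>j\<in>jobs I. P (sp j) * measure lborel (J j)) + C * card (components Z)"
proof -
  define pick where "pick x = (THE j. j \<in> jobs I \<and> x \<in> J j)" for x
  have pick: "pick x = j" if "j \<in> jobs I" "x \<in> J j" for x j
    unfolding pick_def using that disj by (intro the_equality) auto
  let ?U = "\<Union>j\<in>jobs I. J j"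
  define S where "S = \<lparr> asleep = Z, speed = (\<lambda>x. if x \<in> ?U then sp (pick x) else 0),
    current = (\<lambda>x. if x \<in> ?U then Some (pick x) else None) \<rparr>"
  have cur: "current S x = Some j \<longleftrightarrow> j \<in> jobs I \<and> x \<in> J j" for x j
    using pick by (auto simp: S_def)
  have none: "current S x = None \<longleftrightarrow> x \<notin> ?U" for x
    by (auto simp: S_def)
  have speed: "speed S x = sp j" if "j \<in> jobs I" "x \<in> J j" for x j
    using pick that by (auto simp: S_def)
  have speed0: "speed S x = 0" if "x \<notin> ?U" for x using that by (simp add: S_def)
  have JT: "J j \<subseteq> time_span I" if "j \<in> jobs I" for j using cover that by auto
  have J_int: "has_bochner_integral lborel (\<lambda>x. indicator (J j) x * c) (measure lborel (J j) * c)"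
    if "j \<in> jobs I" for j c
  proof -
    have "emeasure lborel (J j) \<le> emeasure lborel (time_span I)"
      using JT[OF that] by (intro emeasure_mono) (auto simp: time_span_def)
    also have "\<dots> < \<infinity>" by (auto simp: time_span_def emeasure_lborel_Icc_eq)
    finally show ?thesis
      using has_bochner_integral_indicator[of "J j" lborel c] meas[OF that] by simp
  qed
  have "feasible I S"
    unfolding feasible_def
  proof (intro conjI ballI allI impI)
    show "asleep S \<subseteq> time_span I" "start_time I \<notin> asleep S" using Z by (auto simp: S_def)
    show "0 \<le> speed S x" for x using sp speed speed0 by (cases "x \<in> ?U") auto
    show "current S x = None" if "x \<in> asleep S" for x
      using that cover unfolding none by (auto simp: S_def)
    show "speed S x = 0" if "current S x = None" for x using that speed0 unfolding none by blast
    show "j \<in> jobs I" "release I j \<le> x" "x \<le> deadline I j" if "current S x = Some j" for x j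
      using that win[of j] unfolding cur by auto
    fix j assume j: "j \<in> jobs I"
    have "indicator {x \<in> time_span I. current S x = Some j} x * speed S x = indicator (J j) x * sp j" for x
      using j JT speed by (auto simp: cur indicator_def)
    then show "has_bochner_integral lborel
        (\<lambda>x. indicator {x \<in> time_span I. current S x = Some j} x * speed S x) (volume I j)"
      using J_int[OF j, of "sp j"] vol[OF j] by (simp add: mult.commute)
  qed
  moreover have en: "has_bochner_integral lborel (\<lambda>x. indicator (time_span I - asleep S) x *\<^sub>R P (speed S x))
      (\<Sum>j\<in>jobs I. P (sp j) * measure lborel (J j))"
  proof -
    \<comment> \<open>Disjointness leaves at most one non-zero summand, so the power can be
      integrated slot by slot.\<close>
    have "indicator (time_span I - asleep S) x *\<^sub>R P (speed S x)
      = (\<Sum>j\<in>jobs I. indicator (J j) x * P (sp j))" for x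
    proof (cases "x \<in> ?U")
      case True
      then obtain j where j: "j \<in> jobs I" "x \<in> J j" by auto
      then have "(\<Sum>i\<in>jobs I. indicator (J i) x * P (sp i)) = (\<Sum>i\<in>jobs I. if j = i then P (sp j) else 0)"
        using disj by (intro sum.cong) (auto simp: indicator_def)
      also have "\<dots> = P (speed S x)" using j fin speed by simp
      finally show ?thesis using True cover by (simp add: S_def)
    next
      case False
      then have "(\<Sum>i\<in>jobs I. indicator (J i) x * P (sp i)) = 0" by (intro sum.neutral) auto
      then show ?thesis using False cover by (simp add: S_def)
    qed
    moreover have "has_bochner_integral lborel (\<lambda>x. \<Sum>j\<in>jobs I. indicator (J j) x * P (sp j))
      (\<Sum>j\<in>jobs I. measure lborel (J j) * P (sp j))"
      by (intro has_bochner_integral_sum J_int)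
    ultimately show ?thesis by (simp add: mult.commute)
  qed
  moreover have "finite_energy P I S"
    using en Z by (simp add: finite_energy_def set_integrable_def has_bochner_integral_iff S_def)
  moreover have "card (wakeups I S) \<le> card (components Z)"
    using Z by (intro card_mono) (auto simp: wakeups_def S_def)
  then have "C * card (wakeups I S) \<le> C * card (components Z)"
    using C by (intro mult_left_mono) auto
  moreover have "(LINT x:(time_span I - asleep S)|lborel. P (speed S x)) = (\<Sum>j\<in>jobs I. P (sp j) * measure lborel (J j))"
    using en unfolding set_lebesgue_integral_def by (rule has_bochner_integral_integral_eq)
  ultimately show ?thesis unfolding energy_def by (intro exI[of _ S]) auto
qed

section \<open>The instance and its time line\<close>

text \<open>The locale keeps just what the energy argument uses of \<open>P\<close>:
  \<open>R\<close> is non-negative and vanishes at \<open>sstar\<close>, and \<open>P\<close> lies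
  strictly above its tangent at \<open>d\<close>, whose slope is \<kappa> + \<open>m\<close>. The
  assumption \<open>L_cost\<close> condenses the choice of \<open>e\<close>, \<open>f\<close> and
  \<open>k\<close>: staying active at speed \<open>d\<close> through a gap costs a wake-up plus
  \<open>m\<close> times the level-0 work that fits in.\<close>

locale reduction =
  fixes P :: "real \<Rightarrow> real" and C \<kappa> m d sstar \<delta> k B :: real
    and n :: nat and a :: "nat \<Rightarrow> nat" and L l :: "nat \<Rightarrow> real"
  assumes C_pos: "C > 0" and m_neg: "m < 0" and k_pos: "k > 0"
    and d_pos: "0 < d" and d_less: "d < sstar" and \<delta>_pos: "\<delta> > 0"
    and P_ge: "\<And>s. s \<ge> 0 \<Longrightarrow> \<kappa> * s \<le> P s" and P_sstar: "P sstar = \<kappa> * sstar"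
    and P_above_tangent: "\<And>s. s \<ge> 0 \<Longrightarrow> s \<noteq> d \<Longrightarrow> P d + (\<kappa> + m) * (s - d) < P s"
    and L_pos: "\<And>i. i \<in> {1..n} \<Longrightarrow> L i > 0"
    and l_pos: "\<And>i. i \<in> {1..n} \<Longrightarrow> l i > 0"
    and a_pos: "\<And>i. i \<in> {1..n} \<Longrightarrow> a i > 0"
    and l_eq: "\<And>i. i \<in> {1..n} \<Longrightarrow> l i = d * L i - a i / k"
    and L_cost: "\<And>i. i \<in> {1..n} \<Longrightarrow> L i * (P d - \<kappa> * d) = C + m * (a i / k)"
    and B_eq: "B = (\<Sum>i=1..n. real (a i)) / (2 * k)"
begin

abbreviation "t \<equiv> tpoint \<delta> L"
abbreviation "IS \<equiv> instance_IS n \<delta> sstar L l B"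

text \<open>Blocks are the closed level-2 windows and gaps are open, so together they partition the
  time span. A level-1 window is a gap with its two endpoints.\<close>

definition block :: "nat \<Rightarrow> real set" where "block j = {t j .. t j + \<delta>}"
definition gap :: "nat \<Rightarrow> real set" where "gap i = {t (i - 1) + \<delta> <..< t i}"

text \<open>Multiplied by \<kappa>, this is the energy for doing all work at speed
  \<open>sstar\<close>, the part of the bound common to all schedules.\<close>

definition total_volume :: real where
  "total_volume = (real n + 1) * (\<delta> * sstar) + (\<Sum>i=1..n. l i) + B"

lemma t_step: "i \<in> {1..n} \<Longrightarrow> t i = t (i - 1) + \<delta> + L i"
  by (cases i) auto

lemma block_end_less: "i < j \<Longrightarrow> j \<le> n \<Longrightarrow> t i + \<delta> < t j"
proof (induction j)
  case (Suc j)
  then show ?case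
    using L_pos[of "Suc j"] \<delta>_pos by (cases "i = j") auto
qed simp

lemma t_less: "i < j \<Longrightarrow> j \<le> n \<Longrightarrow> t i < t j"
  using block_end_less \<delta>_pos by fastforce

lemma t_le: "i \<le> j \<Longrightarrow> j \<le> n \<Longrightarrow> t i \<le> t j"
  using t_less by (cases "i = j") (auto simp: less_le)

lemma t_le_pred: "j < i \<Longrightarrow> i \<le> n \<Longrightarrow> t j \<le> t (i - Suc 0)"
  by (intro t_le) auto

lemma t_nonneg: "j \<le> n \<Longrightarrow> 0 \<le> t j"
  using t_le[of 0 j] by simp

lemma IS_sel:
  "jobs IS = {Level0} \<union> Level1 ` {1..n} \<union> Level2 ` {0..n}"
  "release IS Level0 = 0" "release IS (Level1 i) = t (i - 1) + \<delta>" "release IS (Level2 j) = t j"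
  "deadline IS Level0 = t n + \<delta>" "deadline IS (Level1 i) = t i" "deadline IS (Level2 j) = t j + \<delta>"
  "volume IS Level0 = B" "volume IS (Level1 i) = l i" "volume IS (Level2 j) = \<delta> * sstar"
  by (simp_all add: instance_IS_def)

lemma finite_jobs: "finite (jobs IS)"
  by (simp add: IS_sel)

lemma sum_jobs:
  "(\<Sum>j\<in>jobs IS. g j) = g Level0 + (\<Sum>i=1..n. g (Level1 i)) + (\<Sum>j=0..n. g (Level2 j))"
  for g :: "job \<Rightarrow> real"
proof -
  have "(\<Sum>j\<in>jobs IS. g j) = (\<Sum>j\<in>{Level0}. g j) + (\<Sum>j\<in>Level1 ` {1..n}. g j) + (\<Sum>j\<in>Level2 ` {0..n}. g j)"
    unfolding IS_sel
    by (subst sum.union_disjoint; (subst sum.union_disjoint)?; fastforce)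
  then show ?thesis by (simp add: sum.reindex inj_on_def)
qed

lemma sum_volume: "(\<Sum>j\<in>jobs IS. volume IS j) = total_volume"
  by (simp add: sum_jobs) (simp add: IS_sel total_volume_def algebra_simps)

lemma start_time_IS: "start_time IS = 0"
  unfolding start_time_def
proof (rule Min_eqI)
  show "0 \<in> release IS ` jobs IS" by (force simp: IS_sel)
  fix y assume "y \<in> release IS ` jobs IS"
  then show "0 \<le> y" using t_nonneg \<delta>_pos by (fastforce simp: IS_sel)
qed (simp add: finite_jobs)

lemma time_span_IS: "time_span IS = {0 .. t n + \<delta>}"
proof -
  have "Max (deadline IS ` jobs IS) = t n + \<delta>"
  proof (rule Max_eqI)
    show "t n + \<delta> \<in> deadline IS ` jobs IS" by (force simp: IS_sel)
    fix y assume "y \<in> deadline IS ` jobs IS"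
    then show "y \<le> t n + \<delta>" using t_le[of _ n] \<delta>_pos by (fastforce simp: IS_sel)
  qed (simp add: finite_jobs)
  then show ?thesis by (simp add: time_span_def start_time_IS)
qed

lemma gap_unique: "x \<in> gap i \<Longrightarrow> x \<in> gap j \<Longrightarrow> i \<in> {1..n} \<Longrightarrow> j \<in> {1..n} \<Longrightarrow> i = j"
proof (induction i j rule: linorder_wlog)
  case (le i j)
  show ?case
  proof (rule ccontr)
    assume "i \<noteq> j"
    then have "t i \<le> t (j - 1)" using le by (intro t_le) auto
    then show False using le \<delta>_pos by (auto simp: gap_def)
  qed
qed auto

lemma block_unique: "x \<in> block i \<Longrightarrow> x \<in> block j \<Longrightarrow> i \<le> n \<Longrightarrow> j \<le> n \<Longrightarrow> i = j"
  using block_end_less[of i j] block_end_less[of j i]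
  by (cases i j rule: linorder_cases) (auto simp: block_def)

lemma gap_block_disjoint: "x \<in> gap i \<Longrightarrow> i \<in> {1..n} \<Longrightarrow> j \<le> n \<Longrightarrow> x \<notin> block j"
  using t_le_pred[of j i] t_le[of i j] by (cases "i \<le> j") (auto simp: block_def gap_def)

text \<open>Closed level-1 windows are separated by blocks of positive length. Hence the only
  level-1 job available inside \<open>gap i\<close> is the one with index \<open>i\<close>.\<close>

lemma gap_closed_window:
  "x \<in> gap i \<Longrightarrow> i \<in> {1..n} \<Longrightarrow> j \<in> {1..n} \<Longrightarrow> t (j - 1) + \<delta> \<le> x \<Longrightarrow> x \<le> t j \<Longrightarrow> i = j"
  using t_le_pred[of j i] t_le_pred[of i j] \<delta>_pos
  by (cases i j rule: linorder_cases) (auto simp: gap_def)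

lemma time_span_cases:
  assumes "x \<in> time_span IS"
  obtains j where "j \<le> n" "x \<in> block j" | i where "i \<in> {1..n}" "x \<in> gap i"
proof -
  have "(\<exists>j\<le>N. x \<in> block j) \<or> (\<exists>i\<in>{1..N}. x \<in> gap i)" if "0 \<le> x" "x \<le> t N + \<delta>" for N
    using that
  proof (induction N)
    case 0 then show ?case by (auto simp: block_def)
  next
    case (Suc N)
    consider "x \<le> t N + \<delta>" | "x \<in> gap (Suc N)" | "x \<in> block (Suc N)"
      using Suc.prems by (force simp: block_def gap_def)
    then show ?case
      by cases (use Suc in \<open>fastforce simp: le_Suc_eq\<close>)+
  qed
  from this[of n] show ?thesis using assms that by (auto simp: time_span_IS)
qed

lemma gap_subset: "i \<in> {1..n} \<Longrightarrow> gap i \<subseteq> time_span IS"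
  using t_nonneg[of "i - Suc 0"] t_le[of i n] \<delta>_pos by (force simp: time_span_IS gap_def)

lemma block_subset: "j \<le> n \<Longrightarrow> block j \<subseteq> time_span IS"
  using t_nonneg[of j] t_le[of j n] by (auto simp: time_span_IS block_def)

lemma measure_gap: "i \<in> {1..n} \<Longrightarrow> measure lborel (gap i) = L i"
  using L_pos[of i] t_step[of i] by (simp add: gap_def)

lemma gap_sets [measurable]: "gap i \<in> sets borel" by (simp add: gap_def)

section \<open>From a cheap schedule to a partition\<close>

text \<open>The level-2 job has positive volume, so its processing rate is non-zero somewhere. Such
  a moment separates the sleep periods of the neighbouring gaps.\<close>

lemma awake_in_block:
  assumes S: "feasible IS S" and j: "j \<le> n"
  obtains u where "u \<in> block j" "u \<in> time_span IS" "u \<notin> asleep S"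
proof -
  let ?u = "\<lambda>x. indicator {x \<in> time_span IS. current S x = Some (Level2 j)} x * speed S x"
  have "Level2 j \<in> jobs IS" using j by (simp add: IS_sel)
  then have "has_bochner_integral lborel ?u (volume IS (Level2 j))"
    using S unfolding feasible_def by blast
  then have "integral\<^sup>L lborel ?u \<noteq> 0"
    using \<delta>_pos d_pos d_less by (simp add: has_bochner_integral_integral_eq IS_sel)
  then obtain x where "?u x \<noteq> 0"
    using Bochner_Integration.integral_cong[OF refl, of lborel ?u "\<lambda>_. 0"] by fastforce
  then have x: "x \<in> time_span IS" "current S x = Some (Level2 j)"
    by (auto simp: indicator_def split: if_splits)
  then have "release IS (Level2 j) \<le> x" "x \<le> deadline IS (Level2 j)"
    using S unfolding feasible_def by blast+
  moreover have "x \<notin> asleep S"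
    using S x unfolding feasible_def by auto
  ultimately show ?thesis using that x by (auto simp: IS_sel block_def)
qed

text \<open>Send each gap containing sleep to the sleep period of one of its sleeping points. The
  awake moment in the block after the gap shows both that this period ends in a wake-up and that
  later gaps get different periods.\<close>

lemma sleeping_gaps_le_wakeups:
  assumes S: "feasible IS S" and fin: "finite (components (asleep S))"
  shows "card {i \<in> {1..n}. gap i \<inter> asleep S \<noteq> {}} \<le> card (wakeups IS S)"
proof -
  let ?Z = "{i \<in> {1..n}. gap i \<inter> asleep S \<noteq> {}}"
  define p where "p i = (SOME x. x \<in> gap i \<inter> asleep S)" for i
  have p: "p i \<in> gap i \<inter> asleep S" if "i \<in> ?Z" for i
    unfolding p_def using that by (intro some_in_eq[THEN iffD2]) blast
  let ?K = "\<lambda>i. connected_component_set (asleep S) (p i)"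
  have awake_after: "\<exists>u \<in> time_span IS - asleep S. t i \<le> u \<and> u \<le> t i + \<delta> \<and> (\<forall>x \<in> ?K i. x < u)" if i: "i \<in> ?Z" for i
  proof -
    obtain u where u: "u \<in> block i" "u \<in> time_span IS" "u \<notin> asleep S"
      using awake_in_block[OF S] i by auto
    \<comment> \<open>The component is an interval with a point at or before \<open>u\<close>; a
      point beyond \<open>u\<close> would put the awake time \<open>u\<close> into it.\<close>
    have "x < u" if "x \<in> ?K i" for x
    proof (rule ccontr)
      assume "\<not> x < u"
      moreover have "p i \<le> u" using p[OF i] u by (auto simp: gap_def block_def)
      moreover have "p i \<in> ?K i" using p[OF i] by simp
      ultimately have "u \<in> ?K i"
        using connectedD_interval[OF connected_connected_component, of "p i" "asleep S" "p i" x u] that by linarith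
      then show False using u connected_component_subset by blast
    qed
    then show ?thesis using u by (auto simp: block_def)
  qed
  have "inj_on ?K ?Z"
  proof (rule linorder_inj_onI)
    fix i j assume ij: "i < j" "i \<in> ?Z" "j \<in> ?Z"
    obtain u where u: "u \<le> t i + \<delta>" "\<forall>x \<in> ?K i. x < u"
      using awake_after[OF ij(2)] by blast
    have "t i \<le> t (j - Suc 0)" using t_le_pred[of i j] ij by auto
    then have "u \<le> p j" using u p[OF ij(3)] by (auto simp: gap_def)
    moreover have "p j \<in> ?K j" using p[OF ij(3)] by simp
    ultimately have "p j \<notin> ?K i" using u(2) by auto
    then show "?K i \<noteq> ?K j" using \<open>p j \<in> ?K j\<close> by blast
  qed (rule linear)
  moreover have "?K ` ?Z \<subseteq> wakeups IS S"
  proof (rule image_subsetI)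
    fix i assume i: "i \<in> ?Z"
    then have "?K i \<in> components (asleep S)" using p by (intro componentsI) auto
    then show "?K i \<in> wakeups IS S" using awake_after[OF i] unfolding wakeups_def by blast
  qed
  moreover have "finite (wakeups IS S)"
    using fin by (auto simp: wakeups_def)
  ultimately show ?thesis by (rule card_inj_on_le)
qed

text \<open>The function \<open>h\<close> measures the cost in terms of \<open>R\<close> together
  with a penalty \<open>-m\<close> per unit of level-0 work. The bound leaves at most
  \<open>C\<close> for each gap without sleep, while each such gap needs at least \<open>C\<close>;
  so every estimate is an equality, which determines the level-0 work everywhere.\<close>

lemma partition_if_schedule:
  assumes S: "feasible IS S" and fe: "finite_energy P IS S"
    and en: "energy P C IS S \<le> \<kappa> * total_volume + real n * C + m * B"
  shows "\<exists>N \<subseteq> {1..n}. 2 * (\<Sum>i\<in>N. a i) = (\<Sum>i=1..n. a i)"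
proof -
  define T where "T = time_span IS"
  define Act where "Act = T - asleep S"
  define s where "s = speed S"
  define u where "u j x = indicator {x \<in> T. current S x = Some j} x * s x" for j x
  have fin: "finite (components (asleep S))" using fe by (simp add: finite_energy_def)
  have asleepT: "asleep S \<subseteq> T" using S by (simp add: feasible_def T_def)
  have s_nonneg: "0 \<le> s x" if "x \<in> T" for x
    using S that by (auto simp: feasible_def T_def s_def)
  have idle: "s x = 0" if "x \<in> T" "current S x = None" for x
    using S that by (auto simp: feasible_def T_def s_def)
  have asleep_idle: "s x = 0" if "x \<in> asleep S" for x
    using S that idle asleepT by (auto simp: feasible_def)
  have window: "j \<in> jobs IS \<and> release IS j \<le> x \<and> x \<le> deadline IS j"
    if "x \<in> T" "current S x = Some j" for x j
    using S that by (auto simp: feasible_def T_def)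
  have u_int: "has_bochner_integral lborel (u j) (volume IS j)" if "j \<in> jobs IS" for j
    using S that unfolding u_def[abs_def] T_def s_def by (auto simp: feasible_def)
  have u_nonneg: "0 \<le> u j x" for j x
    using s_nonneg by (auto simp: u_def indicator_def)
  have sum_u: "(\<Sum>j\<in>jobs IS. u j x) = indicator T x * s x" for x
  proof (cases "x \<in> T \<and> current S x \<noteq> None")
    case True
    then obtain j where j: "current S x = Some j" by auto
    then have "(\<Sum>j\<in>jobs IS. u j x) = (\<Sum>i\<in>jobs IS. if j = i then s x else 0)"
      using True by (intro sum.cong) (auto simp: u_def indicator_def)
    also have "\<dots> = s x" using window[of x j] True j finite_jobs by (subst sum.delta') auto
    finally show ?thesis using True by simp
  next
    case False
    then have "u j x = 0" for j by (auto simp: u_def indicator_def)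
    then show ?thesis using False idle by (auto simp: indicator_def)
  qed
  \<comment> \<open>The processing rates \<open>u j\<close> of the single jobs add up to the speed,
    so every feasible schedule does the same total work.\<close>
  have s_int: "has_bochner_integral lborel (\<lambda>x. indicator T x * s x) total_volume"
    using has_bochner_integral_sum[of "jobs IS" lborel u "volume IS", OF u_int]
    by (simp add: sum_u sum_volume)
  define R where "R x = P x - \<kappa> * x" for x
  have R_nonneg: "0 \<le> R x" if "0 \<le> x" for x using P_ge[OF that] by (simp add: R_def)
  define g where "g x = indicator Act x * R (s x)" for x
  define E where "E = (LINT x:Act|lborel. P (s x))"
  have P_int: "has_bochner_integral lborel (\<lambda>x. indicator Act x * P (s x)) E"
    using fe by (simp add: finite_energy_def E_def Act_def T_def s_def set_integrable_def
        set_lebesgue_integral_def has_bochner_integral_integrable)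
  \<comment> \<open>The speed is 0 during sleep, so the linear term may be integrated over all of
    \<open>T\<close>, where its integral is known.\<close>
  have g_eq: "g x = indicator Act x * P (s x) - \<kappa> * (indicator T x * s x)" for x
    using asleep_idle by (auto simp: g_def R_def Act_def indicator_def algebra_simps)
  have g_int: "has_bochner_integral lborel g (E - \<kappa> * total_volume)"
    unfolding g_eq[abs_def]
    by (intro has_bochner_integral_diff P_int has_bochner_integral_mult_right s_int)
  have g_nonneg: "0 \<le> g x" for x
    using s_nonneg R_nonneg by (auto simp: g_def Act_def indicator_def)
  have u0: "has_bochner_integral lborel (u Level0) B"
    using u_int[of Level0] by (simp add: IS_sel)
  define h where "h x = g x - m * u Level0 x" for x
  have h_int: "has_bochner_integral lborel h (E - \<kappa> * total_volume - m * B)"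
    unfolding h_def[abs_def]
    by (intro has_bochner_integral_diff g_int has_bochner_integral_mult_right u0)
  have u0_h: "- m * u Level0 x \<le> h x" for x using g_nonneg by (simp add: h_def)
  have h_nonneg: "0 \<le> h x" for x
    using u0_h[of x] u_nonneg[of Level0 x] m_neg mult_nonneg_nonneg[of "- m" "u Level0 x"] by linarith
  define N where "N = {i \<in> {1..n}. gap i \<inter> asleep S = {}}"
  have finN: "finite N" by (simp add: N_def)
  have wN: "n - card N \<le> card (wakeups IS S)"
  proof -
    have "{i \<in> {1..n}. gap i \<inter> asleep S \<noteq> {}} = {1..n} - N" by (auto simp: N_def)
    then have "card {i \<in> {1..n}. gap i \<inter> asleep S \<noteq> {}} = n - card N"
      using card_Diff_subset[OF finN, of "{1..n}"] by (simp add: N_def subset_iff)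
    then show ?thesis using sleeping_gaps_le_wakeups[OF S fin] by simp
  qed
  \<comment> \<open>Each of the other gaps uses up one of the \<open>n\<close> wake-up costs in the
    bound.\<close>
  have h_le: "integral\<^sup>L lborel h \<le> card N * C"
  proof -
    have "integral\<^sup>L lborel h = E - \<kappa> * total_volume - m * B"
      using h_int by (rule has_bochner_integral_integral_eq)
    also have "\<dots> \<le> (real n - card (wakeups IS S)) * C"
      using en by (simp add: energy_def E_def Act_def T_def s_def algebra_simps)
    also have "\<dots> \<le> card N * C"
      using wN C_pos by (intro mult_right_mono) auto
    finally show ?thesis .
  qed
  \<comment> \<open>The distance of \<open>R\<close> from its tangent at \<open>d\<close>: on a gap
    in \<open>N\<close> it is non-negative and vanishes only at speed \<open>d\<close>.\<close>
  define q where "q i x = indicator (gap i) x * (R (s x) - R d - m * (s x - d))" for i x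
  have gapT: "gap i \<subseteq> T" if "i \<in> N" for i using gap_subset that by (auto simp: N_def T_def)
  have q_pos: "0 < R (s x) - R d - m * (s x - d)" if "x \<in> T" "s x \<noteq> d" for x
    using P_above_tangent[OF s_nonneg[OF that(1)] that(2)] by (simp add: R_def algebra_simps)
  have q_nonneg: "0 \<le> q i x" if "i \<in> N" for i x
  proof (cases "s x = d")
    case False
    then show ?thesis using q_pos[of x] gapT[OF that] by (auto simp: q_def indicator_def less_imp_le)
  qed (simp add: q_def)
  have speed_in_gap: "indicator (gap i) x * s x = indicator (gap i) x * (u Level0 x + u (Level1 i) x)"
    if i: "i \<in> N" for i x
  proof (cases "x \<in> gap i")
    case True
    then have xT: "x \<in> T" using gapT i by auto
    show ?thesis
    proof (cases "current S x")
      case None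
      then show ?thesis using idle xT by (simp add: u_def)
    next
      case (Some j)
      have i': "i \<in> {1..n}" using i by (simp add: N_def)
      have "j = Level0 \<or> j = Level1 i"
      proof (cases j)
        case (Level1 i2)
        then show ?thesis
          using window[OF xT Some] gap_closed_window[OF True i', of i2] by (auto simp: IS_sel)
      next
        case (Level2 j2)
        then show ?thesis
          using window[OF xT Some] gap_block_disjoint[OF True i', of j2] by (auto simp: IS_sel block_def)
      qed simp
      then show ?thesis using Some xT by (auto simp: u_def indicator_def)
    qed
  qed simp
  have l1_int: "has_bochner_integral lborel (\<lambda>x. indicator (gap i) x * u (Level1 i) x) (l i)"
    if i: "i \<in> N" for i
  proof -
    have ui: "has_bochner_integral lborel (u (Level1 i)) (l i)"
      using u_int[of "Level1 i"] i by (auto simp: IS_sel N_def)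
    have [measurable]: "u (Level1 i) \<in> borel_measurable lborel"
      using ui by (rule borel_measurable_has_bochner_integral)
    \<comment> \<open>Outside the gap the level-1 job can only run at the two endpoints of its
      window, a null set.\<close>
    have "AE x in lborel. u (Level1 i) x = indicator (gap i) x * u (Level1 i) x"
      using AE_lborel_singleton[of "t (i - 1) + \<delta>"] AE_lborel_singleton[of "t i"]
    proof eventually_elim
      case (elim x)
      show ?case
      proof (cases "x \<in> T \<and> current S x = Some (Level1 i)")
        case True
        then have "x \<in> gap i" using window[of x "Level1 i"] elim by (auto simp: IS_sel gap_def)
        then show ?thesis by simp
      qed (auto simp: u_def)
    qed
    then show ?thesis using ui by (subst has_bochner_integral_cong_AE[symmetric]) auto
  qed
  have gap_int: "has_bochner_integral lborel (\<lambda>x. indicator (gap i) x * c) (L i * c)"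
    if i: "i \<in> N" for i c
  proof -
    have "has_bochner_integral lborel (\<lambda>x. indicator (gap i) x *\<^sub>R c) (measure lborel (gap i) *\<^sub>R c)"
      using emeasure_bounded_finite[of "gap i"] by (intro has_bochner_integral_indicator) (auto simp: gap_def)
    then show ?thesis using i by (simp add: measure_gap N_def)
  qed
  have h_gap: "integrable lborel (\<lambda>x. indicator A x * h x)" if "A \<in> sets borel" for A
    using integrable_mult_indicator[of A lborel h] h_int that by (auto simp: has_bochner_integral_iff)
  have u0_gap: "integrable lborel (\<lambda>x. indicator A x * u Level0 x)" if "A \<in> sets borel" for A
    using integrable_mult_indicator[of A lborel "u Level0"] u0 that by (auto simp: has_bochner_integral_iff)
  define H where "H A = (LINT x|lborel. indicator A x * h x)" for A
  define W where "W A = (LINT x|lborel. indicator A x * u Level0 x)" for A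
  \<comment> \<open>The level-0 term of \<open>h\<close> cancels the level-0 part of the tangent.
    The remaining tangent terms involve only \<open>L i\<close> and \<open>l i\<close>, and by
    \<open>L_cost\<close> they integrate to exactly \<open>C\<close>.\<close>
  have q_int: "has_bochner_integral lborel (q i) (H (gap i) - C)" if i: "i \<in> N" for i
  proof -
    have q_eq: "q i x = indicator (gap i) x * h x - indicator (gap i) x * (R d - m * d)
        - m * (indicator (gap i) x * u (Level1 i) x)" for x
    proof (cases "x \<in> gap i")
      case True
      then have "x \<in> Act" using gapT[OF i] i by (auto simp: Act_def N_def)
      moreover have "s x = u Level0 x + u (Level1 i) x" using speed_in_gap[OF i, of x] True by simp
      ultimately show ?thesis using True by (simp add: q_def h_def g_def algebra_simps)
    qed (simp add: q_def)
    have i': "i \<in> {1..n}" using i by (simp add: N_def)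
    have "C = L i * (R d - m * d) + m * l i"
      using L_cost[OF i'] by (simp add: l_eq[OF i'] R_def algebra_simps)
    then have C: "H (gap i) - C = H (gap i) - L i * (R d - m * d) - m * l i" by simp
    have "has_bochner_integral lborel (\<lambda>x. indicator (gap i) x * h x) (H (gap i))"
      unfolding H_def using h_gap by (simp add: has_bochner_integral_integrable)
    then show ?thesis unfolding q_eq[abs_def] C
      by (intro has_bochner_integral_diff has_bochner_integral_mult_right gap_int i l1_int)
  qed
  \<comment> \<open>All remaining times: blocks, gaps containing sleep, and the outside of the time
    span.\<close>
  define U where "U = - (\<Union>i\<in>N. gap i)"
  have U_sets: "U \<in> sets borel" unfolding U_def using finN by (intro borel_comp sets.finite_UN) auto
  have split: "(LINT x|lborel. f x) = (LINT x|lborel. indicator U x * f x)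
      + (\<Sum>i\<in>N. LINT x|lborel. indicator (gap i) x * f x)"
    if "\<And>A. A \<in> sets borel \<Longrightarrow> integrable lborel (\<lambda>x. indicator A x * f x)" for f :: "real \<Rightarrow> real"
  proof -
    have "f x = indicator U x * f x + (\<Sum>i\<in>N. indicator (gap i) x * f x)" for x
    proof (cases "x \<in> U")
      case True
      then have "(\<Sum>i\<in>N. indicator (gap i) x * f x) = 0" by (intro sum.neutral) (auto simp: U_def)
      then show ?thesis using True by simp
    next
      case False
      then obtain i where i: "i \<in> N" "x \<in> gap i" by (auto simp: U_def)
      have "x \<in> gap j \<longleftrightarrow> i = j" if "j \<in> N" for j
        using i that gap_unique[of x i j] unfolding N_def by blast
      then have "(\<Sum>j\<in>N. indicator (gap j) x * f x) = (\<Sum>j\<in>N. if i = j then f x else 0)"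
        by (intro sum.cong) (auto simp: indicator_def)
      then show ?thesis using False i finN by simp
    qed
    then have "(LINT x|lborel. f x) = (LINT x|lborel. indicator U x * f x + (\<Sum>i\<in>N. indicator (gap i) x * f x))"
      by (rule Bochner_Integration.integral_cong[OF refl])
    also have "\<dots> = (LINT x|lborel. indicator U x * f x)
      + (\<Sum>i\<in>N. LINT x|lborel. indicator (gap i) x * f x)"
      using that U_sets by (subst Bochner_Integration.integral_add) (auto intro!: Bochner_Integration.integrable_sum)
    finally show ?thesis .
  qed
  have H_split: "integral\<^sup>L lborel h = H U + (\<Sum>i\<in>N. H (gap i))"
    unfolding H_def by (rule split[OF h_gap])
  have W_split: "B = W U + (\<Sum>i\<in>N. W (gap i))"
    using split[OF u0_gap] has_bochner_integral_integral_eq[OF u0] by (simp add: W_def)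
  have HU: "0 \<le> H U" unfolding H_def using h_nonneg by (intro integral_nonneg_AE) auto
  have Hq: "C \<le> H (gap i)" if "i \<in> N" for i
    using q_nonneg[OF that] Bochner_Integration.integral_nonneg[of lborel "q i"] has_bochner_integral_integral_eq[OF q_int[OF that]] by simp
  \<comment> \<open>All terms on the left are non-negative, so each of them vanishes.\<close>
  have sumH: "H U + (\<Sum>i\<in>N. H (gap i) - C) \<le> 0"
    using h_le H_split by (simp add: sum_subtractf)
  have sum0: "0 \<le> (\<Sum>i\<in>N. H (gap i) - C)" using Hq by (intro sum_nonneg) auto
  have HU0: "H U = 0" using sumH sum0 HU by simp
  have HC: "H (gap i) - C = 0" if "i \<in> N" for i
  proof -
    have "(\<Sum>i\<in>N. H (gap i) - C) = 0" using sumH sum0 HU by simp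
    then show ?thesis using that sum_nonneg_eq_0_iff[OF finN, of "\<lambda>i. H (gap i) - C"] Hq by auto
  qed
  \<comment> \<open>Now \<open>q i\<close> vanishes almost everywhere, so the speed in the gap is
    \<open>d\<close> and the work done there is \<open>d * L i\<close>. Removing the level-1 volume
    \<open>l i\<close> leaves the level-0 work.\<close>
  have W_gap: "W (gap i) = a i / k" if i: "i \<in> N" for i
  proof -
    have "integral\<^sup>L lborel (q i) = 0" "integrable lborel (q i)"
      using q_int[OF i] HC[OF i] by (auto simp: has_bochner_integral_iff)
    then have "AE x in lborel. q i x = 0"
      using q_nonneg[OF i] by (subst (asm) integral_nonneg_eq_0_iff_AE) auto
    then have AE: "AE x in lborel. indicator (gap i) x * (u Level0 x + u (Level1 i) x) = indicator (gap i) x * d"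
    proof eventually_elim
      case (elim x)
      then have "indicator (gap i) x * s x = indicator (gap i) x * d"
        using q_pos[of x] gapT[OF i] by (cases "s x = d") (auto simp: q_def indicator_def split: if_splits)
      then show ?case using speed_in_gap[OF i] by simp
    qed
    have w: "has_bochner_integral lborel (\<lambda>x. indicator (gap i) x * (u Level0 x + u (Level1 i) x)) (W (gap i) + l i)"
      unfolding distrib_left W_def using u0_gap
      by (intro has_bochner_integral_add l1_int i) (simp add: has_bochner_integral_integrable)
    have "W (gap i) + l i = L i * d"
      using integral_cong_AE[OF w[THEN borel_measurable_has_bochner_integral]
          gap_int[OF i, THEN borel_measurable_has_bochner_integral] AE]
      unfolding w[THEN has_bochner_integral_integral_eq] gap_int[OF i, THEN has_bochner_integral_integral_eq] .
    then show ?thesis using l_eq[of i] i by (simp add: N_def algebra_simps)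
  qed
  \<comment> \<open>As \<open>H U\<close> is 0 and \<open>m\<close> is negative, no level-0 work is
    done outside the gaps in \<open>N\<close>.\<close>
  have "- m * W U \<le> H U"
  proof -
    have "- m * W U = (LINT x|lborel. - m * (indicator U x * u Level0 x))"
      by (simp add: W_def)
    also have "\<dots> \<le> H U"
      unfolding H_def using u0_h U_sets
      by (intro integral_mono integrable_mult_right u0_gap h_gap) (auto simp: indicator_def)
    finally show ?thesis .
  qed
  then have "W U \<le> 0" using HU0 m_neg by (simp add: zero_le_mult_iff)
  moreover have "0 \<le> W U" unfolding W_def using u_nonneg by (intro integral_nonneg_AE) auto
  ultimately have "B = (\<Sum>i\<in>N. a i / k)" using W_split W_gap by simp
  then have "2 * (\<Sum>i\<in>N. real (a i)) = (\<Sum>i=1..n. real (a i))"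
    using k_pos by (simp add: B_eq sum_divide_distrib[symmetric] field_simps)
  then have "real (2 * (\<Sum>i\<in>N. a i)) = real (\<Sum>i=1..n. a i)" by simp
  then have "2 * (\<Sum>i\<in>N. a i) = (\<Sum>i=1..n. a i)" by (rule of_nat_eq_iff[THEN iffD1])
  then show ?thesis by (intro exI[of _ N]) (auto simp: N_def)
qed

section \<open>From a partition to a cheap schedule\<close>

text \<open>In every gap the level-1 job comes first. The rest of the gap is a level-0 slot if the
  gap is in \<open>N\<close> and a sleep period otherwise.\<close>

lemma schedule_if_partition:
  assumes N: "N \<subseteq> {1..n}" and part: "2 * (\<Sum>i\<in>N. a i) = (\<Sum>i=1..n. a i)"
  shows "\<exists>S. feasible IS S \<and> finite_energy P IS S \<and>
    energy P C IS S \<le> \<kappa> * total_volume + real n * C + m * B"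
proof -
  define v where "v i = (if i \<in> N then d else sstar)" for i
  define mid where "mid i = t (i - 1) + \<delta> + l i / v i" for i
  define tail where "tail i = {mid i <..< t i}" for i
  define J where "J j = (case j of Level0 \<Rightarrow> \<Union>i\<in>N. tail i
    | Level1 i \<Rightarrow> {t (i - 1) + \<delta> <.. mid i} | Level2 j \<Rightarrow> block j)" for j
  define sp where "sp j = (case j of Level0 \<Rightarrow> d | Level1 i \<Rightarrow> v i | Level2 j \<Rightarrow> sstar)" for j
  define Z where "Z = (\<Union>i\<in>{1..n} - N. tail i)"
  have finN: "finite N" using N finite_subset by blast
  have v_pos: "0 < v i" for i using d_pos d_less by (simp add: v_def)
  have mid: "t (i - 1) + \<delta> < mid i" "mid i < t i" if i: "i \<in> {1..n}" for i
  proof -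
    show "t (i - 1) + \<delta> < mid i" using l_pos[OF i] v_pos by (simp add: mid_def)
    \<comment> \<open>Even at the slower speed \<open>d\<close> the level-1 job ends before the gap
      does, so every tail is non-empty.\<close>
    have "l i < d * L i" using l_eq[OF i] a_pos[OF i] k_pos by simp
    also have "\<dots> \<le> v i * L i" using L_pos[OF i] d_less by (intro mult_right_mono) (auto simp: v_def)
    finally have "l i / v i < L i" using v_pos by (simp add: divide_less_eq mult.commute)
    then show "mid i < t i" using t_step[OF i] by (simp add: mid_def)
  qed
  have tail_gap: "tail i \<subseteq> gap i" if "i \<in> {1..n}" for i
    using mid[OF that] by (auto simp: tail_def gap_def)
  have head_gap: "J (Level1 i) \<subseteq> gap i" if "i \<in> {1..n}" for i
    using mid[OF that] by (auto simp: J_def gap_def)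
  have gap_split: "gap i = J (Level1 i) \<union> tail i" if "i \<in> {1..n}" for i
    using mid[OF that] by (auto simp: J_def gap_def tail_def)
  have head_tail: "x \<notin> tail i" if "x \<in> J (Level1 i)" for x i
    using that by (auto simp: J_def tail_def)
  have J_simps: "J Level0 = (\<Union>i\<in>N. tail i)" "J (Level2 j) = block j" for j
    by (auto simp: J_def)
  have sp_simps: "sp Level0 = d" "sp (Level1 i) = v i" "sp (Level2 i) = sstar" for i
    by (auto simp: sp_def)
  have m1: "measure lborel (J (Level1 i)) = l i / v i" if "i \<in> {1..n}" for i
    using mid[OF that] by (simp add: J_def) (simp add: mid_def)
  have m2: "measure lborel (J (Level2 j)) = \<delta>" for j
    using \<delta>_pos by (simp add: J_simps block_def)
  have a_sum: "(\<Sum>i\<in>N. a i / k) = B"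
  proof -
    have "2 * (\<Sum>i\<in>N. real (a i)) = (\<Sum>i=1..n. real (a i))"
      using arg_cong[OF part, of real] by simp
    then show ?thesis using k_pos by (simp add: B_eq sum_divide_distrib[symmetric] field_simps)
  qed
  \<comment> \<open>At speed \<open>d\<close> this tail holds level-0 work \<open>a i / k\<close>,
    so by the partition the tails together hold exactly \<open>B\<close>.\<close>
  have m_tail: "measure lborel (tail i) = a i / k / d" if "i \<in> N" for i
  proof -
    have i: "i \<in> {1..n}" using that N by auto
    have "measure lborel (tail i) = L i - l i / d"
      using mid[OF i] t_step[OF i] that by (simp add: tail_def) (simp add: mid_def v_def)
    also have "\<dots> = a i / k / d" using d_pos by (simp add: l_eq[OF i] diff_divide_distrib)
    finally show ?thesis .
  qed
  have m0: "measure lborel (J Level0) = B / d"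
  proof -
    have "measure lborel (J Level0) = (\<Sum>i\<in>N. measure lborel (tail i))"
      unfolding J_simps
    proof (rule measure_finite_Union[OF finN])
      show "disjoint_family_on tail N"
        using tail_gap gap_unique N unfolding disjoint_family_on_def by blast
      show "emeasure lborel (tail i) \<noteq> \<infinity>" for i
        using emeasure_bounded_finite[of "tail i"] by (simp add: tail_def less_top[symmetric])
    qed (auto simp: tail_def)
    also have "\<dots> = (\<Sum>i\<in>N. a i / k) / d" unfolding sum_divide_distrib by (rule sum.cong) (auto simp: m_tail)
    finally show ?thesis unfolding a_sum .
  qed
  have notZ: "x \<notin> Z" if "i \<in> {1..n}" "x \<in> gap i" "i \<in> N \<or> x \<notin> tail i" for x i
    using that gap_unique tail_gap unfolding Z_def by blast
  have cover: "time_span IS - Z = (\<Union>j\<in>jobs IS. J j)"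
  proof
    show "time_span IS - Z \<subseteq> (\<Union>j\<in>jobs IS. J j)"
    proof
      fix x assume x: "x \<in> time_span IS - Z"
      then have "x \<in> time_span IS" by simp
      then show "x \<in> (\<Union>j\<in>jobs IS. J j)"
      proof (cases rule: time_span_cases)
        case (1 j)
        then have "x \<in> J (Level2 j)" "Level2 j \<in> jobs IS" by (auto simp: J_simps IS_sel)
        then show ?thesis by blast
      next
        case (2 i)
        show ?thesis
        proof (cases "x \<in> J (Level1 i)")
          case True
          then show ?thesis using 2 by (auto simp: IS_sel)
        next
          case False
          then have "x \<in> tail i" "i \<in> N" using 2 x gap_split by (auto simp: Z_def)
          then show ?thesis by (auto simp: IS_sel J_simps)
        qed
      qed
    qed
    show "(\<Union>j\<in>jobs IS. J j) \<subseteq> time_span IS - Z"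
    proof
      fix x assume "x \<in> (\<Union>j\<in>jobs IS. J j)"
      then consider i where "i \<in> N" "x \<in> tail i" | i where "i \<in> {1..n}" "x \<in> J (Level1 i)"
        | j where "j \<le> n" "x \<in> block j"
        by (auto simp: IS_sel J_simps)
      then show "x \<in> time_span IS - Z"
      proof cases
        case (1 i)
        then have "i \<in> {1..n}" "x \<in> gap i" using N tail_gap by blast+
        then show ?thesis using 1 gap_subset notZ by blast
      next
        case (2 i)
        then have "x \<in> gap i" using head_gap by blast
        then show ?thesis using 2 gap_subset notZ head_tail by blast
      next
        case (3 j)
        then show ?thesis using block_subset gap_block_disjoint tail_gap unfolding Z_def by blast
      qed
    qed
  qed
  have job_cases: "j = Level0 \<or> (\<exists>i\<in>{1..n}. j = Level1 i) \<or> (\<exists>i\<le>n. j = Level2 i)" if "j \<in> jobs IS" for j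
    using that by (auto simp: IS_sel)
  \<comment> \<open>The sleep set is a union of one interval for each gap outside
    \<open>N\<close>.\<close>
  have comp: "finite (components Z)" "card (components Z) \<le> n - card N"
  proof -
    have con: "connected (tail i)" for i by (simp add: tail_def)
    show "finite (components Z)"
      unfolding Z_def by (rule card_components_UN_le(1)) (auto simp: con)
    have "card (components Z) \<le> card ({1..n} - N)"
      unfolding Z_def by (rule card_components_UN_le(2)) (auto simp: con)
    also have "\<dots> = n - card N" using card_Diff_subset[OF finN N] by simp
    finally show "card (components Z) \<le> n - card N" .
  qed
  have "\<exists>S. feasible IS S \<and> finite_energy P IS S \<and>
    energy P C IS S \<le> (\<Sum>j\<in>jobs IS. P (sp j) * measure lborel (J j)) + C * card (components Z)"
  proof (rule schedule_of_disjoint_slots)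
    show "finite (jobs IS)" by (rule finite_jobs)
    show "i = j" if ij: "i \<in> jobs IS" "j \<in> jobs IS" and x: "x \<in> J i" "x \<in> J j" for i j x
    proof -
      have A: "y \<notin> J (Level1 i)" if "y \<in> J Level0" "i \<in> {1..n}" for y i
        using that N head_tail tail_gap head_gap gap_unique unfolding J_simps by blast
      have B: "y \<notin> J (Level2 i)" if "y \<in> J Level0" "i \<le> n" for y i
        using that N tail_gap gap_block_disjoint unfolding J_simps by blast
      have C: "y \<notin> J (Level2 i)" if "y \<in> J (Level1 i')" "i \<le> n" "i' \<in> {1..n}" for y i i'
        using that head_gap gap_block_disjoint unfolding J_simps by blast
      have D: "i = i'" if "y \<in> J (Level1 i)" "y \<in> J (Level1 i')" "i \<in> {1..n}" "i' \<in> {1..n}" for y i i'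
        using that head_gap gap_unique by blast
      have E: "i = i'" if "y \<in> J (Level2 i)" "y \<in> J (Level2 i')" "i \<le> n" "i' \<le> n" for y i i'
        using that block_unique unfolding J_simps by blast
      from job_cases[OF ij(1)] job_cases[OF ij(2)] show ?thesis
        using x A B C D E by metis
    qed
    show "J j \<subseteq> {release IS j .. deadline IS j}" if "j \<in> jobs IS" for j
      using job_cases[OF that]
    proof (elim disjE bexE exE conjE)
      assume "j = Level0"
      moreover have "J Level0 \<subseteq> time_span IS"
        using N tail_gap gap_subset unfolding J_simps by blast
      ultimately show ?thesis by (simp add: time_span_IS IS_sel)
    next
      fix i assume "i \<in> {1..n}" "j = Level1 i"
      then show ?thesis using head_gap[of i] by (auto simp: IS_sel gap_def)
    qed (auto simp: IS_sel J_simps block_def)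
    show "J j \<in> sets borel" if "j \<in> jobs IS" for j
      using finN by (cases j) (auto simp: J_def tail_def block_def)
    show "0 \<le> sp j" for j
      using d_pos d_less v_pos by (cases j) (auto simp: sp_simps less_imp_le)
    show "volume IS j = sp j * measure lborel (J j)" if "j \<in> jobs IS" for j
      using job_cases[OF that] m0 m1 m2 v_pos d_pos by (fastforce simp: sp_simps IS_sel less_imp_neq[symmetric])
    show "Z \<subseteq> time_span IS" using tail_gap gap_subset unfolding Z_def by blast
    have "0 \<in> block 0" using \<delta>_pos by (simp add: block_def)
    then have "0 \<in> (\<Union>j\<in>jobs IS. J j)" by (force simp: IS_sel J_simps)
    then show "start_time IS \<notin> Z" using cover by (auto simp: start_time_IS)
    show "finite (components Z)" "time_span IS - Z = (\<Union>j\<in>jobs IS. J j)" "0 \<le> C"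
      using comp cover C_pos by auto
  qed
  moreover have "(\<Sum>j\<in>jobs IS. P (sp j) * measure lborel (J j)) + C * card (components Z)
      \<le> \<kappa> * total_volume + real n * C + m * B"
  proof -
    have cardN: "card N \<le> n" using card_mono[OF _ N] by simp
    have "C * card (components Z) \<le> C * (real n - card N)"
      using comp(2) cardN C_pos by (intro mult_left_mono) auto
    \<comment> \<open>At speed \<open>sstar\<close> a unit of work costs \<kappa>; at speed
      \<open>d\<close> it costs \<open>R d / d\<close> more.\<close>
    moreover have "(\<Sum>i=1..n. P (v i) * (l i / v i))
      = \<kappa> * (\<Sum>i=1..n. l i) + (\<Sum>i\<in>N. (P d - \<kappa> * d) * (l i / d))"
    proof -
      have "(\<Sum>i=1..n. P (v i) * (l i / v i)) = (\<Sum>i=1..n. \<kappa> * l i + (if i \<in> N then (P d - \<kappa> * d) * (l i / d) else 0))"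
        using d_pos d_less by (intro sum.cong) (auto simp: v_def P_sstar field_simps)
      also have "\<dots> = \<kappa> * (\<Sum>i=1..n. l i) + (\<Sum>i\<in>{1..n} \<inter> N. (P d - \<kappa> * d) * (l i / d))"
        by (simp only: sum.distrib sum_distrib_left sum.inter_restrict[OF finite_atLeastAtMost])
      also have "{1..n} \<inter> N = N" using N by auto
      finally show ?thesis .
    qed
    \<comment> \<open>In a gap of \<open>N\<close> level-0 and level-1 work add up to
      \<open>d * L i\<close>, so its excess cost is the left side of \<open>L_cost\<close>.\<close>
    moreover have "(P d - \<kappa> * d) * (B / d) + (\<Sum>i\<in>N. (P d - \<kappa> * d) * (l i / d)) = card N * C + m * B"
    proof -
      have "(P d - \<kappa> * d) * (B / d) + (\<Sum>i\<in>N. (P d - \<kappa> * d) * (l i / d))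
        = (\<Sum>i\<in>N. (P d - \<kappa> * d) * ((a i / k + l i) / d))"
        unfolding a_sum[symmetric] by (simp add: sum_divide_distrib sum_distrib_left sum.distrib add_divide_distrib distrib_left)
      also have "\<dots> = (\<Sum>i\<in>N. C + m * (a i / k))"
      proof (rule sum.cong[OF refl])
        fix i assume "i \<in> N"
        then have i: "i \<in> {1..n}" using N by auto
        show "(P d - \<kappa> * d) * ((a i / k + l i) / d) = C + m * (a i / k)"
          using L_cost[OF i] d_pos by (simp add: l_eq[OF i] mult.commute)
      qed
      also have "\<dots> = card N * C + m * B"
        unfolding a_sum[symmetric] by (simp add: sum.distrib sum_distrib_left)
      finally show ?thesis .
    qed
    moreover have "(\<Sum>j\<in>jobs IS. P (sp j) * measure lborel (J j))
      = P d * (B / d) + (\<Sum>i=1..n. P (v i) * (l i / v i)) + (real n + 1) * (\<kappa> * sstar * \<delta>)"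
      by (simp add: sum_jobs sp_simps m0 m2 P_sstar) (simp add: m1)
    moreover have "P d * (B / d) = (P d - \<kappa> * d) * (B / d) + \<kappa> * B"
      using d_pos by (simp add: field_simps)
    ultimately show ?thesis by (simp add: total_volume_def algebra_simps)
  qed
  ultimately show ?thesis by (meson order_trans)
qed

end

section \<open>Verification of the parameters\<close>

theorem theorem1:
  fixes P P' P'' :: "real \<Rightarrow> real" and C sstar \<epsilon> \<delta> :: real
    and n :: nat and a :: "nat \<Rightarrow> nat"
  assumes "C > 0"
    and "\<And>s. s \<ge> 0 \<Longrightarrow> (P has_real_derivative P' s) (at s within {0..})"
    and "\<And>s. s \<ge> 0 \<Longrightarrow> (P' has_real_derivative P'' s) (at s within {0..})"
    and "P 0 > 0"
    and "\<And>s. s \<ge> 0 \<Longrightarrow> P'' s > 0"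
    and "sstar > 0"
    and "antimono_on {0<..<sstar} (\<lambda>s. P s / s)"
    and "\<And>s. s > 0 \<Longrightarrow> P sstar / sstar \<le> P s / s"
    and "n \<ge> 1"
    and "\<And>i. i \<in> {1..n} \<Longrightarrow> a i > 0"
    and "Max (a ` {1..n}) \<ge> 2"
    and "0 < \<epsilon>" and "\<epsilon> < 1 / 2" and "\<delta> > 0"
  defines "R \<equiv> \<lambda>s. P s - P sstar / sstar * s"
    and "d \<equiv> (1 - \<epsilon>) * sstar"
  defines "e \<equiv> C / R d"
    and "f \<equiv> C / (P 0 * real (Max (a ` {1..n})))"
  defines "k \<equiv> - deriv R d / (f * R d)"
  defines "L \<equiv> \<lambda>i. e - f * real (a i)"
  defines "l \<equiv> \<lambda>i. d * L i - real (a i) / k"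
    and "B \<equiv> (\<Sum>i=1..n. real (a i)) / (2 * k)"
    and "F \<equiv> \<lambda>x. P sstar / sstar * x + C"
  defines "A \<equiv> image_mset a (mset_set {1..n})"
    and "IS \<equiv> instance_IS n \<delta> sstar L l B"
  shows "(\<exists>A'. A' \<subseteq># A \<and> \<Sum>\<^sub># A' = \<Sum>\<^sub># (A - A')) \<longleftrightarrow>
    (\<exists>S. feasible IS S \<and> finite_energy P IS S \<and>
       energy P C IS S \<le> (real n + 1) * \<delta> * P sstar + (\<Sum>i=1..n. F (l i)) + B * P' d)"
proof -
  note C = assms(1) and P = assms(2) and P' = assms(3) and P0 = assms(4) and P'' = assms(5)
    and sstar = assms(6) and slope = assms(8) and a = assms(10) and eps = assms(12,13) and \<delta> = assms(14)
  define \<kappa> where "\<kappa> = P sstar / sstar"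
  define m where "m = P' d - \<kappa>"
  define amax where "amax = Max (a ` {1..n})"
  have d: "0 < d" "d < sstar" using eps sstar by (auto simp: d_def)
  have sstar_d: "sstar - d = \<epsilon> * sstar" by (simp add: d_def algebra_simps)
  have tangent: "P x + P' x * (y - x) < P y" if "0 \<le> x" "0 \<le> y" "x \<noteq> y" for x y
    using above_tangent_if_second_derivative_pos[OF P P' P''] that by blast
  have P_ge: "\<kappa> * s \<le> P s" if "s \<ge> 0" for s
    using slope[of s] P0 that by (cases "s = 0") (auto simp: \<kappa>_def field_simps)
  have P_sstar: "P sstar = \<kappa> * sstar" using sstar by (simp add: \<kappa>_def)
  have P_at: "(P has_real_derivative P' s) (at s)" if "s > 0" for s
    using P[of s] that at_within_interior[of s "{0..}"] by simp
  have R_deriv: "(R has_real_derivative (P' s - \<kappa>)) (at s)" if "s > 0" for s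
    unfolding R_def \<kappa>_def using P_at[OF that] sstar by (auto intro!: derivative_eq_intros)
  have deriv_R: "deriv R d = m" using R_deriv[OF d(1)] by (simp add: m_def DERIV_imp_deriv)
  have R: "R s = P s - \<kappa> * s" for s by (simp add: R_def \<kappa>_def)
  \<comment> \<open>\<open>R\<close> is non-negative and vanishes at the interior point
    \<open>sstar\<close>, a local minimum. The radius \<open>sstar\<close> keeps the neighbourhood
    inside the domain.\<close>
  have P'_sstar: "P' sstar = \<kappa>"
  proof -
    have "P' sstar - \<kappa> = 0"
    proof (rule DERIV_local_min[OF R_deriv[OF sstar] sstar], intro allI impI)
      fix y assume "\<bar>sstar - y\<bar> < sstar"
      then have "0 \<le> y" by simp
      then show "R sstar \<le> R y" using P_ge[of y] P_sstar by (simp add: R)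
    qed
    then show ?thesis by simp
  qed
  \<comment> \<open>The tangent of \<open>P\<close> at \<open>sstar\<close> is the line through the
    origin with slope \<kappa>.\<close>
  have Rd_pos: "0 < R d"
    using tangent[of sstar d] d sstar by (simp add: R P'_sstar P_sstar algebra_simps)
  \<comment> \<open>The tangent of \<open>R\<close> at \<open>d\<close>, evaluated at
    \<open>sstar\<close>, lies below \<open>R sstar\<close>, which is 0.\<close>
  have Rd_less: "R d < - m * (\<epsilon> * sstar)"
    using tangent[of d sstar] d sstar eps unfolding sstar_d by (simp add: R m_def P_sstar d_def algebra_simps)
  have m_neg: "m < 0"
  proof -
    have "0 < - m * (\<epsilon> * sstar)" using Rd_pos Rd_less by linarith
    then show ?thesis using eps sstar by (simp add: zero_less_mult_iff mult_less_0_iff)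
  qed
  \<comment> \<open>Jensen's inequality: \<open>d\<close> is the average of 0 and
    \<open>sstar\<close> with weights \<epsilon> and 1 - \<epsilon>, where \<open>R\<close> takes
    the values \<open>P 0\<close> and 0.\<close>
  have Rd_P0: "R d < \<epsilon> * P 0"
  proof -
    have 1: "P d + P' d * (0 - d) < P 0" using tangent[of d 0] d by simp
    have 2: "P d + P' d * (sstar - d) < P sstar" using tangent[of d sstar] d by simp
    have "\<epsilon> * (P d + P' d * (0 - d)) + (1 - \<epsilon>) * (P d + P' d * (sstar - d)) < \<epsilon> * P 0 + (1 - \<epsilon>) * P sstar"
      using 1 2 eps by (intro add_strict_mono mult_strict_left_mono) auto
    moreover have "\<epsilon> * (P d + P' d * (0 - d)) + (1 - \<epsilon>) * (P d + P' d * (sstar - d)) = P d"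
      by (simp add: d_def algebra_simps)
    ultimately show ?thesis by (simp add: R P_sstar d_def algebra_simps)
  qed
  have a_le: "a i \<le> amax" if "i \<in> {1..n}" for i
    using that by (auto simp: amax_def intro!: Max_ge)
  have amax: "amax \<ge> 2" using assms(11) by (simp add: amax_def)
  have f_pos: "f > 0" using C P0 amax by (simp only: f_def flip: amax_def) simp
  have k_eq: "k = - m / (f * R d)" by (simp add: k_def deriv_R)
  have k_pos: "k > 0" using m_neg f_pos Rd_pos by (simp add: k_eq divide_less_0_iff)
  have fa_le: "f * a i \<le> C / P 0" if "i \<in> {1..n}" for i
  proof -
    have "f * a i \<le> f * amax" using a_le[OF that] f_pos by simp
    also have "\<dots> = C / P 0" using amax by (simp only: f_def flip: amax_def) simp
    finally show ?thesis .
  qed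
  have inv_k: "a i / k = f * a i * (R d / - m)" for i by (simp add: k_eq)
  have Rdm: "R d / - m \<le> \<epsilon> * sstar" using Rd_less m_neg by (simp add: field_simps)
  \<comment> \<open>Here \<epsilon> < 1/2 enters, replacing the factor \<epsilon> in
    \<open>Rd_P0\<close> by 1 - \<epsilon>.\<close>
  have CP0: "C / P 0 < (1 - \<epsilon>) * e"
  proof -
    have "R d < (1 - \<epsilon>) * P 0"
      using Rd_P0 eps P0 mult_right_mono[of \<epsilon> "1 - \<epsilon>" "P 0"] by linarith
    then have "C * R d < C * ((1 - \<epsilon>) * P 0)" using C by simp
    then show ?thesis using P0 Rd_pos by (simp add: e_def field_simps)
  qed
  \<comment> \<open>The claim is that \<open>f * a i * d + a i / k\<close> stays below
    \<open>d * e\<close>. The bound on \<open>R d / - m\<close> turns the left side into at most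
    \<open>f * a i * sstar\<close>, and \<open>f\<close> is scaled so that \<open>f * a i\<close> is
    at most \<open>C / P 0\<close>.\<close>
  have l_pos: "l i > 0" if "i \<in> {1..n}" for i
  proof -
    have "f * a i * d + a i / k \<le> f * a i * d + f * a i * (\<epsilon> * sstar)"
      unfolding inv_k using Rdm f_pos by (intro add_left_mono mult_left_mono) auto
    also have "\<dots> = f * a i * sstar" by (simp add: d_def algebra_simps)
    also have "\<dots> \<le> C / P 0 * sstar" using fa_le[OF that] sstar by (intro mult_right_mono) auto
    also have "\<dots> < (1 - \<epsilon>) * e * sstar" using CP0 sstar by (rule mult_strict_right_mono)
    also have "\<dots> = d * e" by (simp add: d_def)
    finally show ?thesis by (simp add: l_def L_def algebra_simps)
  qed
  have L_pos: "L i > 0" if "i \<in> {1..n}" for i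
  proof -
    have "0 < d * L i" using l_pos[OF that] a[OF that] k_pos by (smt (verit) l_def divide_nonneg_pos of_nat_0_le_iff)
    then show ?thesis using d by (simp add: zero_less_mult_iff)
  qed
  \<comment> \<open>By the choice of \<open>e\<close>, \<open>e * R d\<close> is \<open>C\<close>;
    by the choice of \<open>k\<close>, \<open>m * (a i / k)\<close> is the negative of
    \<open>f * a i * R d\<close>.\<close>
  have L_cost: "L i * (P d - \<kappa> * d) = C + m * (a i / k)" for i
    unfolding inv_k R[symmetric] using Rd_pos m_neg by (simp add: L_def e_def left_diff_distrib)
  interpret reduction P C \<kappa> m d sstar \<delta> k B n a L l
  proof
    show "P d + (\<kappa> + m) * (s - d) < P s" if "0 \<le> s" "s \<noteq> d" for s
      using tangent[of d s] that d by (simp add: m_def)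
    show "l i = d * L i - real (a i) / k" "B = (\<Sum>i=1..n. real (a i)) / (2 * k)" for i
      by (simp_all only: l_def B_def)
  qed (fact C m_neg k_pos d \<delta> P_ge P_sstar L_pos l_pos a | rule L_cost)+
  have F: "F x = \<kappa> * x + C" for x by (simp add: F_def \<kappa>_def)
  \<comment> \<open>Since \<open>P' d\<close> is \<kappa> + \<open>m\<close>, the last term splits
    into the cost of the level-0 volume at rate \<kappa> and \<open>m * B\<close>.\<close>
  have bound: "(real n + 1) * \<delta> * P sstar + (\<Sum>i=1..n. F (l i)) + B * P' d
    = \<kappa> * total_volume + real n * C + m * B"
    by (simp add: F total_volume_def P_sstar m_def sum.distrib sum_distrib_left[symmetric] algebra_simps)
  show ?thesis
    unfolding bound unfolding A_def IS_def halving_submultiset_iff[OF finite_atLeastAtMost]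
    using partition_if_schedule schedule_if_partition by blast
qed

end
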